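(* Let $H$ be a complex Hilbert space and let $T\in\mathcal{B}(H)$ be normal. Suppose $T\in\mathcal{AM}(H)$, and let $\Lambda=\sigma(|T|)$, where $|T|=\sqrt{T^*T}$. Then there exists a family of pairs $(H_\beta,U_\beta)_{\beta\in\Lambda}$, where each $H_\beta$ is a reducing subspace for $T$ and each $U_\beta\in\mathcal{B}(H_\beta)$ is unitary, such that (1) $H=\bigoplus_{\beta\in\Lambda}H_\beta$, (2) $T=\bigoplus_{\beta\in\Lambda}\beta U_\beta$.
   Context: $\mathcal{B}(H)$ is the space of bounded linear operators on $H$. $T$ is normal if $TT^*=T^*T$. A bounded operator $S:H_1\to H_2$ between Hilbert spaces is minimum attaining if there is a unit vector $x\in H_1$ with $\|Sx\|=m(S)$, where $m(S)=\inf\{\|Sx\|:x\in H_1,\ \|x\|=1\}$. $T\in\mathcal{B}(H)$ is absolutely minimum attaining, written $T\in\mathcal{AM}(H)$, if for every nonzero closed subspace $M\subseteq H$ the restriction $T|_M:M\to H$ is minimum attaining. A closed subspace $M$ is reducing for $T$ if both $M$ and $M^\perp$ are invariant under $T$; reducing subspaces $H_\beta$ are allowed to be $\{0\}$. The direct sum in (1) is the orthogonal Hilbert space direct sum, and (2) means $Tx=\beta U_\beta x$ for every $\beta\in\Lambda$ and $x\in H_\beta$. *)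

theory Defs
  imports "HOL-Analysis.Analysis"
begin

text \<open>
  A complex Hilbert space, with its underlying real Hilbert space structure (real scalars, real
  inner product \<open>Re \<langle>x, y\<rangle>\<close>) supplied by the library classes. In particular
  \<open>norm x = sqrt (Re \<langle>x, x\<rangle>)\<close>. The inner product is linear in the first argument.
\<close>

class chilbert_space = real_inner + complete_space +
  fixes scaleC :: "complex \<Rightarrow> 'a \<Rightarrow> 'a" (infixr "*\<^sub>C" 75)
    and cinner :: "'a \<Rightarrow> 'a \<Rightarrow> complex"
  assumes scaleC_add_right: "a *\<^sub>C (x + y) = a *\<^sub>C x + a *\<^sub>C y"
    and scaleC_add_left: "(a + b) *\<^sub>C x = a *\<^sub>C x + b *\<^sub>C x"
    and scaleC_scaleC: "a *\<^sub>C (b *\<^sub>C x) = (a * b) *\<^sub>C x"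
    and scaleR_scaleC: "r *\<^sub>R x = complex_of_real r *\<^sub>C x"
    and cinner_commute: "cinner x y = cnj (cinner y x)"
    and cinner_add_left: "cinner (x + y) z = cinner x z + cinner y z"
    and cinner_scaleC_left: "cinner (a *\<^sub>C x) y = a * cinner x y"
    and inner_eq_Re_cinner: "inner x y = Re (cinner x y)"

lemma scaleC_one: "1 *\<^sub>C (x :: 'a::chilbert_space) = x"
  using scaleR_scaleC[of 1 x] by simp

lemma cinner_self: "cinner x x = complex_of_real ((norm (x :: 'a::chilbert_space))\<^sup>2)"
proof (rule complex_eqI)
  show "Re (cinner x x) = Re (complex_of_real ((norm x)\<^sup>2))"
    by (simp add: power2_norm_eq_inner inner_eq_Re_cinner)
  have "Im (cinner x x) = - Im (cinner x x)"
    by (subst cinner_commute) simp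
  then show "Im (cinner x x) = Im (complex_of_real ((norm x)\<^sup>2))"
    by simp
qed

instantiation complex :: chilbert_space
begin
definition scaleC_complex :: "complex \<Rightarrow> complex \<Rightarrow> complex"
  where "scaleC_complex a x = a * x"
definition cinner_complex :: "complex \<Rightarrow> complex \<Rightarrow> complex"
  where "cinner_complex x y = x * cnj y"
instance
  by standard (auto simp: scaleC_complex_def cinner_complex_def algebra_simps scaleR_conv_of_real
      inner_complex_def)
end

definition bounded_clinear :: "('a::chilbert_space \<Rightarrow> 'b::chilbert_space) \<Rightarrow> bool"
  where "bounded_clinear T \<longleftrightarrow> bounded_linear T \<and> (\<forall>c x. T (c *\<^sub>C x) = c *\<^sub>C T x)"

definition cadjoint :: "('a::chilbert_space \<Rightarrow> 'b::chilbert_space) \<Rightarrow> 'b \<Rightarrow> 'a"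
  where "cadjoint T = (THE S. \<forall>x y. cinner (T x) y = cinner x (S y))"

definition normal_op :: "('a::chilbert_space \<Rightarrow> 'a) \<Rightarrow> bool"
  where "normal_op T \<longleftrightarrow> T \<circ> cadjoint T = cadjoint T \<circ> T"

definition positive_op :: "('a::chilbert_space \<Rightarrow> 'a) \<Rightarrow> bool"
  where "positive_op A \<longleftrightarrow>
    bounded_clinear A \<and> (\<forall>x. Im (cinner (A x) x) = 0 \<and> 0 \<le> Re (cinner (A x) x))"

text \<open>Meaningful for positive \<open>A\<close>, which have exactly one positive square root.\<close>

definition sqrt_op :: "('a::chilbert_space \<Rightarrow> 'a) \<Rightarrow> 'a \<Rightarrow> 'a"
  where "sqrt_op A = (THE S. positive_op S \<and> S \<circ> S = A)"

definition modulus_op :: "('a::chilbert_space \<Rightarrow> 'a) \<Rightarrow> 'a \<Rightarrow> 'a"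
  where "modulus_op T = sqrt_op (cadjoint T \<circ> T)"

definition spectrum :: "('a::chilbert_space \<Rightarrow> 'a) \<Rightarrow> complex set"
  where "spectrum A = {z. \<not> (\<exists>B. bounded_clinear B \<and>
    (\<forall>x. B (A x - z *\<^sub>C x) = x) \<and> (\<forall>x. A (B x) - z *\<^sub>C B x = x))}"

definition closed_csubspace :: "'a::chilbert_space set \<Rightarrow> bool"
  where "closed_csubspace M \<longleftrightarrow> closed M \<and> 0 \<in> M \<and>
    (\<forall>x\<in>M. \<forall>y\<in>M. x + y \<in> M) \<and> (\<forall>c. \<forall>x\<in>M. c *\<^sub>C x \<in> M)"

definition orthogonal_compl :: "'a::chilbert_space set \<Rightarrow> 'a set"
  where "orthogonal_compl M = {x. \<forall>y\<in>M. cinner x y = 0}"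

definition reducing_subspace :: "('a::chilbert_space \<Rightarrow> 'a) \<Rightarrow> 'a set \<Rightarrow> bool"
  where "reducing_subspace T M \<longleftrightarrow> closed_csubspace M \<and>
    T ` M \<subseteq> M \<and> T ` orthogonal_compl M \<subseteq> orthogonal_compl M"

text \<open>
  The number \<open>m(T|\<^sub>M)\<close> and attainment of it, for the restriction of \<open>T\<close> to a nonzero subspace
  \<open>M\<close> (so that the infimum is over a nonempty set).
\<close>

definition min_modulus_on ::
    "'a::chilbert_space set \<Rightarrow> ('a \<Rightarrow> 'b::chilbert_space) \<Rightarrow> real"
  where "min_modulus_on M T = Inf {norm (T x) | x. x \<in> M \<and> norm x = 1}"

definition minimum_attaining_on ::
    "'a::chilbert_space set \<Rightarrow> ('a \<Rightarrow> 'b::chilbert_space) \<Rightarrow> bool"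
  where "minimum_attaining_on M T \<longleftrightarrow>
    (\<exists>x\<in>M. norm x = 1 \<and> norm (T x) = min_modulus_on M T)"

definition absolutely_minimum_attaining ::
    "('a::chilbert_space \<Rightarrow> 'b::chilbert_space) \<Rightarrow> bool"
  where "absolutely_minimum_attaining T \<longleftrightarrow> bounded_clinear T \<and>
    (\<forall>M. closed_csubspace M \<and> M \<noteq> {0} \<longrightarrow> minimum_attaining_on M T)"

text \<open>
  An operator on a closed subspace \<open>M\<close> is represented by a function on the whole space of which
  only the values on \<open>M\<close> matter. In \<open>unitary_on\<close>, \<open>V\<close> is the Hilbert space adjoint of \<open>U\<close> in
  \<open>\<B>(M)\<close>, and the last two clauses are \<open>U\<^sup>* U = U U\<^sup>* = I\<close> on \<open>M\<close>.
\<close>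

definition bounded_operator_on :: "'a::chilbert_space set \<Rightarrow> ('a \<Rightarrow> 'a) \<Rightarrow> bool"
  where "bounded_operator_on M U \<longleftrightarrow> U ` M \<subseteq> M \<and>
    (\<forall>x\<in>M. \<forall>y\<in>M. U (x + y) = U x + U y) \<and>
    (\<forall>c. \<forall>x\<in>M. U (c *\<^sub>C x) = c *\<^sub>C U x) \<and>
    (\<exists>K. \<forall>x\<in>M. norm (U x) \<le> K * norm x)"

definition unitary_on :: "'a::chilbert_space set \<Rightarrow> ('a \<Rightarrow> 'a) \<Rightarrow> bool"
  where "unitary_on M U \<longleftrightarrow> bounded_operator_on M U \<and>
    (\<exists>V. bounded_operator_on M V \<and>
      (\<forall>x\<in>M. \<forall>y\<in>M. cinner (U x) y = cinner x (V y)) \<and>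
      (\<forall>x\<in>M. V (U x) = x) \<and> (\<forall>x\<in>M. U (V x) = x))"

text \<open>
  The whole space is the (internal, orthogonal) Hilbert space direct sum of closed subspaces:
  they are mutually orthogonal, and every vector is a norm-convergent unordered sum of components
  (unique by orthogonality).
\<close>

definition hilbert_direct_sum :: "'i set \<Rightarrow> ('i \<Rightarrow> 'a::chilbert_space set) \<Rightarrow> bool"
  where "hilbert_direct_sum I H \<longleftrightarrow>
    (\<forall>i\<in>I. closed_csubspace (H i)) \<and>
    (\<forall>i\<in>I. \<forall>j\<in>I. i \<noteq> j \<longrightarrow> (\<forall>x\<in>H i. \<forall>y\<in>H j. cinner x y = 0)) \<and>
    (\<forall>x. \<exists>f. (\<forall>i\<in>I. f i \<in> H i) \<and> (f has_sum x) I)"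

end

theory Submission
  imports Defs
begin

text \<open>
  The proof diagonalises \<open>T\<^sup>* T\<close> directly. If \<open>M\<close> is a nonzero closed subspace invariant under
  \<open>T\<^sup>* T\<close>, then a unit vector of \<open>M\<close> at which \<open>T|\<^sub>M\<close> attains its minimum is an eigenvector of
  \<open>T\<^sup>* T\<close>, because it minimises the quadratic form of a self-adjoint operator on \<open>M\<close>
  (\<open>minimum_attaining_on_imp_singular_vector\<close>). The common orthogonal complement of all eigenspaces
  of \<open>T\<^sup>* T\<close> is such an invariant subspace and contains no eigenvector, so it is zero, and \<open>H\<close> is the
  orthogonal sum of the spaces \<open>ker (T\<^sup>* T - b\<^sup>2)\<close> with \<open>b \<ge> 0\<close>
  (\<open>hilbert_direct_sum_singular_spaces\<close>).

  This decomposition also yields the modulus. The diagonal operator with value \<open>b\<close> on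
  \<open>ker (T\<^sup>* T - b\<^sup>2)\<close> is a positive square root of \<open>T\<^sup>* T\<close>, and every positive square root has to act
  in this way (\<open>eigenspace_square_positive_op\<close>). Hence \<open>|T|\<close> is this operator,
  \<open>ker (|T| - b) = ker (T\<^sup>* T - b\<^sup>2)\<close>, and an operator that commutes with \<open>T\<^sup>* T\<close> commutes with \<open>|T|\<close>.

  The summands of the theorem are \<open>H\<^sub>\<beta> = ker (|T| - \<beta>)\<close>, which is \<open>{0}\<close> when \<open>\<beta>\<close> lies in the spectrum
  without being an eigenvalue. Normality makes both \<open>T\<close> and \<open>T\<^sup>*\<close> commute with \<open>T\<^sup>* T\<close>, so both
  preserve each \<open>H\<^sub>\<beta>\<close>, which is therefore reducing. On \<open>H\<^sub>\<beta>\<close> with \<open>\<beta> \<noteq> 0\<close> the identities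
  \<open>T\<^sup>* T = T T\<^sup>* = \<beta>\<^sup>2\<close> say that \<open>T / \<beta>\<close> is unitary; on \<open>H\<^sub>0 = ker T\<close> the identity serves as the
  unitary.
\<close>

section \<open>Complex inner products and linear maps\<close>

lemma cinner_commute_eq_0: "cinner x y = 0 \<longleftrightarrow> cinner y x = 0"
  for x y :: "'a::chilbert_space"
  by (metis cinner_commute complex_cnj_zero)

lemma cinner_scaleC_right: "cinner x (a *\<^sub>C y) = cnj a * cinner x y"
  for x y :: "'a::chilbert_space"
  by (metis cinner_commute cinner_scaleC_left complex_cnj_mult)

text \<open>
  Linearity and continuity of the complex inner product, and orthogonality to a complex subspace, are
  obtained from the real inner product through this formula.
\<close>

lemma cinner_eq_inner:
  "cinner x y = complex_of_real (inner x y) + \<i> * complex_of_real (inner x (\<i> *\<^sub>C y))"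
  for x y :: "'a::chilbert_space"
  by (simp add: inner_eq_Re_cinner cinner_scaleC_right complex_eq_iff)

lemma bounded_linear_cinner_left: "bounded_linear (\<lambda>x::'a::chilbert_space. cinner x y)"
  unfolding cinner_eq_inner
  by (intro bounded_linear_add bounded_linear_const_mult bounded_linear_of_real
      bounded_linear_compose[OF bounded_linear_of_real] bounded_linear_inner_left)

lemmas cinner_diff_left = linear_diff[OF bounded_linear.linear[OF bounded_linear_cinner_left]]
lemmas cinner_zero_left = linear_0[OF bounded_linear.linear[OF bounded_linear_cinner_left]]
lemmas cinner_sum_left = linear_sum[OF bounded_linear.linear[OF bounded_linear_cinner_left]]

lemma cinner_zero_right: "cinner x 0 = 0" for x :: "'a::chilbert_space"
  by (simp add: cinner_commute_eq_0[of x] cinner_zero_left)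

lemma cinner_diff_right: "cinner x (y - z) = cinner x y - cinner x z"
  for x y z :: "'a::chilbert_space"
  by (metis cinner_commute cinner_diff_left complex_cnj_diff)

lemma cinner_self_eq_0: "cinner x x = 0 \<longleftrightarrow> x = 0" for x :: "'a::chilbert_space"
  by (simp add: cinner_self)

lemma norm_scaleC: "norm (c *\<^sub>C x) = cmod c * norm x" for x :: "'a::chilbert_space"
proof -
  have "complex_of_real ((norm (c *\<^sub>C x))\<^sup>2) = c * cnj c * complex_of_real ((norm x)\<^sup>2)"
    by (simp only: cinner_self[symmetric] cinner_scaleC_left cinner_scaleC_right mult.assoc mult.left_commute)
  also have "\<dots> = complex_of_real ((cmod c * norm x)\<^sup>2)"
    by (simp add: complex_norm_square[symmetric] power_mult_distrib)
  finally have "(norm (c *\<^sub>C x))\<^sup>2 = (cmod c * norm x)\<^sup>2"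
    by (simp only: of_real_eq_iff)
  then show ?thesis
    by (simp add: power2_eq_iff_nonneg)
qed

lemma bounded_linear_scaleC: "bounded_linear (\<lambda>x::'a::chilbert_space. c *\<^sub>C x)"
  by (rule bounded_linear_intro[where K = "cmod c"])
    (simp_all add: scaleC_add_right scaleR_scaleC scaleC_scaleC norm_scaleC mult.commute)

lemmas scaleC_diff_right = linear_diff[OF bounded_linear.linear[OF bounded_linear_scaleC]]
lemmas scaleC_zero_right = linear_0[OF bounded_linear.linear[OF bounded_linear_scaleC]]

lemma scaleC_zero_left: "0 *\<^sub>C (x::'a::chilbert_space) = 0"
  using scaleR_scaleC[of 0 x] by simp

lemma scaleC_diff_left: "(a - b) *\<^sub>C x = a *\<^sub>C x - b *\<^sub>C x" for x :: "'a::chilbert_space"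
  by (metis add_diff_cancel diff_add_cancel scaleC_add_left)

lemma scaleC_minus_left: "(- a) *\<^sub>C x = - (a *\<^sub>C x)" for x :: "'a::chilbert_space"
  using scaleC_diff_left[of 0 a x] by (simp add: scaleC_zero_left)

lemma bounded_clinear_add:
  assumes "bounded_clinear T" shows "T (x + y) = T x + T y"
  using assms linear_add bounded_linear.linear unfolding bounded_clinear_def by blast

lemma bounded_clinear_diff:
  assumes "bounded_clinear T" shows "T (x - y) = T x - T y"
  using assms linear_diff bounded_linear.linear unfolding bounded_clinear_def by blast

lemma bounded_clinear_zero:
  assumes "bounded_clinear T" shows "T 0 = 0"
  using assms linear_0 bounded_linear.linear unfolding bounded_clinear_def by blast

lemma bounded_clinear_scaleC:
  assumes "bounded_clinear T" shows "T (c *\<^sub>C x) = c *\<^sub>C T x"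
  using assms unfolding bounded_clinear_def by blast

lemma bounded_clinear_scaleR:
  assumes "bounded_clinear T" shows "T (r *\<^sub>R x) = r *\<^sub>R T x"
  by (simp add: scaleR_scaleC bounded_clinear_scaleC[OF assms])

lemma bounded_clinear_bound:
  assumes "bounded_clinear T"
  obtains K where "K \<ge> 0" "\<And>x. norm (T x) \<le> K * norm x"
  using assms bounded_linear.nonneg_bounded unfolding bounded_clinear_def
  by (metis mult.commute)

lemma bounded_clinear_compose:
  assumes "bounded_clinear S" "bounded_clinear T"
  shows "bounded_clinear (S \<circ> T)"
  using assms bounded_linear_compose unfolding bounded_clinear_def by (auto simp: o_def)

lemma closed_csubspace_subspace: "closed_csubspace M \<Longrightarrow> subspace M"
  by (auto simp: closed_csubspace_def subspace_def scaleR_scaleC)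

lemma closed_csubspace_add: "closed_csubspace M \<Longrightarrow> x \<in> M \<Longrightarrow> y \<in> M \<Longrightarrow> x + y \<in> M"
  by (simp add: closed_csubspace_def)

lemma closed_csubspace_scaleC: "closed_csubspace M \<Longrightarrow> x \<in> M \<Longrightarrow> c *\<^sub>C x \<in> M"
  by (simp add: closed_csubspace_def)

lemma closed_csubspace_diff: "closed_csubspace M \<Longrightarrow> x \<in> M \<Longrightarrow> y \<in> M \<Longrightarrow> x - y \<in> M"
  using closed_csubspace_subspace subspace_diff by blast

lemma cinner_eq_0_if_inner:
  fixes x :: "'a::chilbert_space"
  assumes "closed_csubspace M" "\<And>y. y \<in> M \<Longrightarrow> inner x y = 0" "y \<in> M"
  shows "cinner x y = 0"
  using assms by (simp add: cinner_eq_inner closed_csubspace_def)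

section \<open>Orthogonal projections and adjoints\<close>

lemma linear_term_zero_of_quadratic_nonneg:
  fixes a b :: real
  assumes "\<And>t. 0 \<le> 2 * t * a + t\<^sup>2 * b"
  shows "a = 0"
proof (rule ccontr)
  assume a: "a \<noteq> 0"
  \<comment> \<open>Near the origin the linear term dominates; this \<open>t\<close> is small enough in either case for
    the sign of \<open>b\<close>.\<close>
  define t where "t = - a / (\<bar>b\<bar> + 1)"
  have t: "t * (\<bar>b\<bar> + 1) = - a" by (simp add: t_def)
  have "0 \<le> t * (2 * a + t * b)"
    using assms[of t] by (simp add: algebra_simps power2_eq_square)
  also have "t * (2 * a + t * b) = t * (t * b - 2 * (t * (\<bar>b\<bar> + 1)))"
    unfolding t by simp
  also have "\<dots> = t\<^sup>2 * (b - 2 * \<bar>b\<bar> - 2)"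
    by (simp add: algebra_simps power2_eq_square)
  also have "\<dots> < 0"
    using a by (intro mult_pos_neg) (auto simp: t_def)
  finally show False by simp
qed

text \<open>
  The representing vector minimises \<open>\<parallel>y\<parallel>\<^sup>2 - 2 f y\<close> over \<open>M\<close>: by the parallelogram law every
  minimising sequence is Cauchy, and at the minimum the first variation vanishes. Taking
  \<open>f = inner x\<close> gives the orthogonal projection of \<open>x\<close>, taking \<open>M\<close> to be the whole space gives
  adjoints.
\<close>

lemma riesz_representation_closed_subspace:
  fixes f :: "'a::{real_inner,complete_space} \<Rightarrow> real"
  assumes M: "closed M" "subspace M" and f: "bounded_linear f"
  obtains p where "p \<in> M" "\<And>y. y \<in> M \<Longrightarrow> f y = inner p y"
proof -
  define J where "J y = (norm y)\<^sup>2 - 2 * f y" for y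
  have lin: "linear f" using f by (rule bounded_linear.linear)
  obtain K where K: "\<And>y. norm (f y) \<le> norm y * K"
    using bounded_linear.bounded[OF f] by blast
  have J_lower: "J y \<ge> - K\<^sup>2" for y
  proof -
    have "0 \<le> (norm y - K)\<^sup>2" by simp
    then show ?thesis
      using K[of y] by (simp add: J_def power2_eq_square algebra_simps)
  qed
  define d where "d = Inf (J ` M)"
  have bdd: "bdd_below (J ` M)" using J_lower by (meson bdd_belowI2)
  have d_le: "d \<le> J y" if "y \<in> M" for y
    unfolding d_def using bdd that by (simp add: cINF_lower)
  have "\<exists>y\<in>M. J y < d + 1 / Suc n" for n
  proof -
    have "Inf (J ` M) < d + 1 / Suc n" by (simp add: d_def)
    moreover have "J ` M \<noteq> {}" using M subspace_0 by blast
    ultimately show ?thesis using cInf_lessD[of "J ` M"] by fast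
  qed
  then obtain u where uM: "\<And>n. u n \<in> M" and u: "\<And>n. J (u n) < d + 1 / Suc n"
    by metis
  have dist_u: "(norm (u m - u n))\<^sup>2 \<le> 2 / Suc m + 2 / Suc n" for m n
  proof -
    have "(norm (u m - u n))\<^sup>2 = 2 * J (u m) + 2 * J (u n) - 4 * J ((1/2) *\<^sub>R (u m + u n))"
      using lin by (simp add: J_def power2_norm_eq_inner linear_add linear_scale inner_add_left
          inner_add_right inner_diff_left inner_diff_right inner_commute algebra_simps)
    moreover have "d \<le> J ((1/2) *\<^sub>R (u m + u n))"
      using M uM by (intro d_le) (simp add: subspace_add subspace_scale)
    ultimately show ?thesis using u[of m] u[of n] by linarith
  qed
  have "Cauchy u"
  proof (rule metric_CauchyI)
    fix e :: real assume "e > 0"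
    then obtain N where N: "4 / e\<^sup>2 < real N" using reals_Archimedean2 by blast
    then have "N > 0" using \<open>e > 0\<close> by (metis divide_nonneg_nonneg gr0I less_le_not_le of_nat_0 zero_le_numeral zero_le_power2)
    have "dist (u m) (u n) < e" if "m \<ge> N" "n \<ge> N" for m n
    proof -
      have "2 / Suc m \<le> 2 / N" "2 / Suc n \<le> 2 / N"
        using that \<open>N > 0\<close> by (auto intro!: divide_left_mono)
      moreover have "4 / N < e\<^sup>2"
        using N \<open>N > 0\<close> \<open>e > 0\<close> by (simp add: field_simps)
      ultimately have "(norm (u m - u n))\<^sup>2 < e\<^sup>2"
        using dist_u[of m n] by linarith
      then show ?thesis
        using \<open>e > 0\<close> power_less_imp_less_base by (fastforce simp: dist_norm)
    qed
    then show "\<exists>M. \<forall>m\<ge>M. \<forall>n\<ge>M. dist (u m) (u n) < e" by blast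
  qed
  then obtain p where p: "u \<longlonglongrightarrow> p"
    using Cauchy_convergent convergent_def by blast
  have pM: "p \<in> M" using M p uM by (meson closed_sequentially)
  have "(\<lambda>n. J (u n)) \<longlonglongrightarrow> J p"
    unfolding J_def by (intro tendsto_intros p bounded_linear.tendsto[OF f])
  moreover have "(\<lambda>n. d + 1 / Suc n) \<longlonglongrightarrow> d + 0"
    by (intro tendsto_intros LIMSEQ_Suc[OF lim_1_over_n])
  ultimately have "J p \<le> d + 0"
    by (rule LIMSEQ_le) (use u in \<open>auto intro: less_imp_le\<close>)
  then have "J p \<le> d" by simp
  have "f y = inner p y" if "y \<in> M" for y
  proof -
    have "0 \<le> 2 * t * (inner p y - f y) + t\<^sup>2 * (inner y y)" for t
    proof -
      have "J p \<le> J (p + t *\<^sub>R y)"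
        using \<open>J p \<le> d\<close> d_le M pM that by (meson order_trans subspace_add subspace_scale)
      moreover have "(norm (p + t *\<^sub>R y))\<^sup>2 = (norm p)\<^sup>2 + 2 * t * inner p y + t\<^sup>2 * inner y y"
        by (simp add: power2_norm_eq_inner inner_add_left inner_add_right inner_commute
            algebra_simps power2_eq_square[of t])
      ultimately show ?thesis
        using lin by (simp add: J_def linear_add linear_scale algebra_simps)
    qed
    then show ?thesis using linear_term_zero_of_quadratic_nonneg by fastforce
  qed
  with pM that show thesis by blast
qed

lemma orthogonal_projection_exists:
  fixes x :: "'a::chilbert_space"
  assumes M: "closed_csubspace M"
  shows "\<exists>p\<in>M. \<forall>y\<in>M. cinner (x - p) y = 0"
proof -
  obtain p where p: "p \<in> M" "\<And>y. y \<in> M \<Longrightarrow> inner x y = inner p y"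
    using riesz_representation_closed_subspace[of M "inner x"] M closed_csubspace_subspace[OF M]
      bounded_linear_inner_right unfolding closed_csubspace_def by metis
  then have "cinner (x - p) y = 0" if "y \<in> M" for y
    using cinner_eq_0_if_inner[OF M _ that, of "x - p"] by (simp add: inner_diff_left)
  with p show ?thesis by blast
qed

definition orth_proj :: "'a::chilbert_space set \<Rightarrow> 'a \<Rightarrow> 'a"
  where "orth_proj M x = (SOME p. p \<in> M \<and> (\<forall>y\<in>M. cinner (x - p) y = 0))"

lemma
  assumes "closed_csubspace M"
  shows orth_proj_in: "orth_proj M x \<in> M"
    and orth_proj_orthogonal: "y \<in> M \<Longrightarrow> cinner (x - orth_proj M x) y = 0"
  using someI_ex[of "\<lambda>p. p \<in> M \<and> (\<forall>y\<in>M. cinner (x - p) y = 0)"]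
    orthogonal_projection_exists[OF assms, of x] unfolding orth_proj_def by blast+

lemma orth_proj_eqI:
  assumes M: "closed_csubspace M" and p: "p \<in> M" "\<And>y. y \<in> M \<Longrightarrow> cinner (x - p) y = 0"
  shows "orth_proj M x = p"
proof -
  have "cinner (p - orth_proj M x) y = 0" if "y \<in> M" for y
    using p(2)[OF that] orth_proj_orthogonal[OF M that, of x] by (simp add: cinner_diff_left)
  from this[of "p - orth_proj M x"] show ?thesis
    by (simp add: M p orth_proj_in closed_csubspace_diff cinner_self_eq_0)
qed

lemma orth_proj_id:
  assumes "closed_csubspace M" "x \<in> M"
  shows "orth_proj M x = x"
  using assms by (intro orth_proj_eqI) (auto simp: cinner_zero_left)

lemma orth_proj_eq_0:
  assumes "closed_csubspace M" "\<And>y. y \<in> M \<Longrightarrow> cinner x y = 0"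
  shows "orth_proj M x = 0"
  using assms by (intro orth_proj_eqI) (auto simp: closed_csubspace_def)

lemma orth_proj_add:
  assumes M: "closed_csubspace M"
  shows "orth_proj M (x + y) = orth_proj M x + orth_proj M y"
proof (rule orth_proj_eqI[OF M])
  fix z assume z: "z \<in> M"
  show "cinner (x + y - (orth_proj M x + orth_proj M y)) z = 0"
    using orth_proj_orthogonal[OF M z, of x] orth_proj_orthogonal[OF M z, of y]
    by (simp add: cinner_diff_left cinner_add_left)
qed (simp add: M orth_proj_in closed_csubspace_add)

lemma orth_proj_scaleC:
  assumes M: "closed_csubspace M"
  shows "orth_proj M (c *\<^sub>C x) = c *\<^sub>C orth_proj M x"
proof (rule orth_proj_eqI[OF M])
  fix z assume z: "z \<in> M"
  show "cinner (c *\<^sub>C x - c *\<^sub>C orth_proj M x) z = 0"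
    using orth_proj_orthogonal[OF M z, of x]
    by (simp add: cinner_scaleC_left flip: scaleC_diff_right)
qed (simp add: M orth_proj_in closed_csubspace_scaleC)

lemma cinner_orth_proj_self:
  assumes M: "closed_csubspace M"
  shows "cinner (orth_proj M x) x = complex_of_real ((norm (orth_proj M x))\<^sup>2)"
proof -
  have "cinner (x - orth_proj M x) (orth_proj M x) = 0"
    using M by (simp add: orth_proj_in orth_proj_orthogonal)
  then have "cinner (orth_proj M x) (x - orth_proj M x) = 0"
    by (simp only: cinner_commute_eq_0)
  then show ?thesis by (simp add: cinner_diff_right cinner_self)
qed

lemma cadjoint_exists:
  fixes T :: "'a::chilbert_space \<Rightarrow> 'b::chilbert_space"
  assumes T: "bounded_clinear T"
  shows "\<exists>z. \<forall>x. cinner (T x) y = cinner x z"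
proof -
  have "bounded_linear (\<lambda>x. inner (T x) y)"
    using T bounded_linear_compose[OF bounded_linear_inner_left, of T]
    by (simp add: bounded_clinear_def)
  then obtain z where z: "\<And>x. inner (T x) y = inner z x"
    using riesz_representation_closed_subspace[of UNIV "\<lambda>x. inner (T x) y"] by auto
  have "cinner (T x) y = cinner x z" for x
  proof (rule complex_eqI)
    show "Re (cinner (T x) y) = Re (cinner x z)"
      using z[of x] by (simp add: inner_commute flip: inner_eq_Re_cinner)
    show "Im (cinner (T x) y) = Im (cinner x z)"
    proof -
      have "Re (cinner (T (\<i> *\<^sub>C x)) y) = Re (cinner (\<i> *\<^sub>C x) z)"
        using z[of "\<i> *\<^sub>C x"] by (simp add: inner_commute flip: inner_eq_Re_cinner)
      then show ?thesis
        by (simp add: cinner_scaleC_left bounded_clinear_scaleC[OF T])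
    qed
  qed
  then show ?thesis by blast
qed

lemma cinner_extensional:
  fixes y z :: "'a::chilbert_space"
  assumes "\<And>x. cinner x y = cinner x z"
  shows "y = z"
  using assms[of "y - z"] cinner_self_eq_0[of "y - z"] by (simp add: cinner_diff_right)

lemma cinner_cadjoint:
  fixes T :: "'a::chilbert_space \<Rightarrow> 'b::chilbert_space"
  assumes T: "bounded_clinear T"
  shows "cinner (T x) y = cinner x (cadjoint T y)"
proof -
  have "\<exists>!S. \<forall>x y. cinner (T x) y = cinner x (S y)"
  proof (rule ex_ex1I)
    show "\<exists>S. \<forall>x y. cinner (T x) y = cinner x (S y)"
      using cadjoint_exists[OF T] by metis
    fix S R assume "\<forall>x y. cinner (T x) y = cinner x (S y)" "\<forall>x y. cinner (T x) y = cinner x (R y)"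
    then have "cinner x (S y) = cinner x (R y)" for x y by metis
    then show "S = R" using cinner_extensional by blast
  qed
  from theI'[OF this] show ?thesis unfolding cadjoint_def by blast
qed

lemma cinner_cadjoint_left:
  assumes T: "bounded_clinear T"
  shows "cinner (cadjoint T x) y = cinner x (T y)"
  using cinner_cadjoint[OF T, of y x] cinner_commute[of "cadjoint T x" y]
    cinner_commute[of x "T y"] by simp

lemma bounded_clinear_cadjoint:
  assumes T: "bounded_clinear T"
  shows "bounded_clinear (cadjoint T)"
proof -
  let ?S = "cadjoint T"
  have scale: "?S (c *\<^sub>C x) = c *\<^sub>C ?S x" for c x
  proof (rule cinner_extensional)
    fix z
    show "cinner z (?S (c *\<^sub>C x)) = cinner z (c *\<^sub>C ?S x)"
      by (simp add: cinner_scaleC_right flip: cinner_cadjoint[OF T])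
  qed
  obtain K where K: "K \<ge> 0" "\<And>x. norm (T x) \<le> K * norm x"
    using bounded_clinear_bound[OF T] by blast
  have "bounded_linear ?S"
  proof (rule bounded_linear_intro[where K = K])
    fix x y
    show "?S (x + y) = ?S x + ?S y"
    proof (rule cinner_extensional)
      fix z
      have "cinner (?S (x + y)) z = cinner (?S x + ?S y) z"
        by (simp add: cinner_cadjoint_left[OF T] cinner_add_left)
      then show "cinner z (?S (x + y)) = cinner z (?S x + ?S y)"
        by (simp only: cinner_commute[of z])
    qed
  next
    fix r x
    show "?S (r *\<^sub>R x) = r *\<^sub>R ?S x" by (simp add: scaleR_scaleC scale)
  next
    fix x
    have "(norm (?S x))\<^sup>2 = Re (cinner (T (?S x)) x)"
      by (simp add: cinner_cadjoint[OF T] cinner_self)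
    also have "\<dots> \<le> norm (T (?S x)) * norm x"
      by (simp add: norm_cauchy_schwarz flip: inner_eq_Re_cinner)
    also have "\<dots> \<le> K * norm (?S x) * norm x"
      using K by (simp add: mult_right_mono)
    finally have "norm (?S x) * norm (?S x) \<le> norm (?S x) * (norm x * K)"
      by (simp add: power2_eq_square algebra_simps)
    then show "norm (?S x) \<le> norm x * K"
      using K by (cases "norm (?S x) = 0") (auto dest: mult_left_le_imp_le)
  qed
  with scale show ?thesis unfolding bounded_clinear_def by blast
qed

section \<open>Orthogonal direct sums and diagonal operators\<close>

lemma pythagoras_sum:
  fixes f :: "'i \<Rightarrow> 'a::real_inner"
  assumes "finite F" "\<And>i j. i \<in> F \<Longrightarrow> j \<in> F \<Longrightarrow> i \<noteq> j \<Longrightarrow> inner (f i) (f j) = 0"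
  shows "(norm (sum f F))\<^sup>2 = (\<Sum>i\<in>F. (norm (f i))\<^sup>2)"
  using assms by (intro norm_sum_Pythagorean) (auto simp: pairwise_def orthogonal_def)

text \<open>
  By Pythagoras the net of finite partial sums is Cauchy as soon as the squared norms of the terms
  have bounded partial sums.
\<close>

lemma orthogonal_summable_on:
  fixes f :: "'i \<Rightarrow> 'a::{real_inner,complete_space}"
  assumes orth: "\<And>i j. i \<in> I \<Longrightarrow> j \<in> I \<Longrightarrow> i \<noteq> j \<Longrightarrow> inner (f i) (f j) = 0"
    and bound: "\<And>F. finite F \<Longrightarrow> F \<subseteq> I \<Longrightarrow> (\<Sum>i\<in>F. (norm (f i))\<^sup>2) \<le> B"
  shows "f summable_on I"
proof -
  define g where "g i = (norm (f i))\<^sup>2" for i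
  define L where "L = Sup (sum g ` {F. F \<subseteq> I \<and> finite F})"
  have bdd: "bdd_above (sum g ` {F. F \<subseteq> I \<and> finite F})"
    by (rule bdd_aboveI2[where M = B]) (use bound in \<open>auto simp: g_def\<close>)
  have le_L: "sum g F \<le> L" if "F \<subseteq> I" "finite F" for F
    unfolding L_def using that bdd by (intro cSUP_upper) auto
  have "\<exists>P. eventually P (finite_subsets_at_top I) \<and>
      (\<forall>F F'. P F \<and> P F' \<longrightarrow> dist (sum f F) (sum f F') < e)" if "e > 0" for e
  proof -
    have "L - (e/2)\<^sup>2 < L" using that by simp
    moreover have "sum g ` {F. F \<subseteq> I \<and> finite F} \<noteq> {}" by blast
    ultimately obtain F0 where F0: "F0 \<subseteq> I" "finite F0" "L - (e/2)\<^sup>2 < sum g F0"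
      unfolding L_def by (elim less_cSupE) auto
    define P where "P F \<longleftrightarrow> finite F \<and> F0 \<subseteq> F \<and> F \<subseteq> I" for F
    have near: "dist (sum f F) (sum f F0) < e/2" if "P F" for F
    proof -
      have F: "finite F" "F0 \<subseteq> F" "F \<subseteq> I" using that by (auto simp: P_def)
      have "(norm (sum f F - sum f F0))\<^sup>2 = (norm (sum f (F - F0)))\<^sup>2"
        using F by (simp add: sum_diff)
      also have "\<dots> = sum g (F - F0)"
        unfolding g_def using F by (intro pythagoras_sum orth) auto
      also have "\<dots> = sum g F - sum g F0" using F by (simp add: sum_diff)
      also have "\<dots> < (e/2)\<^sup>2" using le_L[of F] F F0 by linarith
      finally show ?thesis
        using \<open>e > 0\<close> power_less_imp_less_base[of _ 2 "e/2"] by (simp add: dist_norm)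
    qed
    have "eventually P (finite_subsets_at_top I)"
      unfolding eventually_finite_subsets_at_top P_def using F0 by blast
    moreover have "dist (sum f F) (sum f F') < e" if "P F" "P F'" for F F'
      using near[OF that(1)] near[OF that(2)]
        dist_triangle2[of "sum f F" "sum f F'" "sum f F0"] by linarith
    ultimately show ?thesis by blast
  qed
  then have "cauchy_filter (filtermap (sum f) (finite_subsets_at_top I))"
    by (simp add: cauchy_filter_metric_filtermap)
  moreover have "complete (UNIV::'a set)"
    by (meson Cauchy_convergent UNIV_I complete_def convergent_def)
  ultimately obtain s where "(sum f \<longlongrightarrow> s) (finite_subsets_at_top I)"
    using complete_uniform[where S=UNIV] by (force simp add: filterlim_def)
  then show ?thesis unfolding summable_on_def has_sum_def by blast
qed

definition orthogonal_family :: "'i set \<Rightarrow> ('i \<Rightarrow> 'a::chilbert_space set) \<Rightarrow> bool"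
  where "orthogonal_family I H \<longleftrightarrow> (\<forall>i\<in>I. closed_csubspace (H i)) \<and>
    (\<forall>i\<in>I. \<forall>j\<in>I. i \<noteq> j \<longrightarrow> (\<forall>x\<in>H i. \<forall>y\<in>H j. cinner x y = 0))"

lemma orthogonal_familyD:
  assumes "orthogonal_family I H"
  shows "i \<in> I \<Longrightarrow> closed_csubspace (H i)"
    and "i \<in> I \<Longrightarrow> j \<in> I \<Longrightarrow> i \<noteq> j \<Longrightarrow> x \<in> H i \<Longrightarrow> y \<in> H j \<Longrightarrow> cinner x y = 0"
    and "i \<in> I \<Longrightarrow> j \<in> I \<Longrightarrow> i \<noteq> j \<Longrightarrow> x \<in> H i \<Longrightarrow> y \<in> H j \<Longrightarrow> inner x y = 0"
  using assms unfolding orthogonal_family_def inner_eq_Re_cinner by auto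

lemma orthogonal_family_orth_proj_in:
  assumes "orthogonal_family I H" "i \<in> I"
  shows "orth_proj (H i) x \<in> H i"
  using assms by (simp add: orthogonal_familyD(1) orth_proj_in)

text \<open>
  By Pythagoras \<open>\<parallel>s\<parallel>\<^sup>2 = \<langle>s, x\<rangle>\<close> for the sum \<open>s\<close> of the projections, so the inequality is
  \<open>0 \<le> \<parallel>x - s\<parallel>\<^sup>2\<close>.
\<close>

lemma bessel_inequality:
  fixes H :: "'i \<Rightarrow> 'a::chilbert_space set"
  assumes H: "orthogonal_family I H" and F: "finite F" "F \<subseteq> I"
  shows "(\<Sum>i\<in>F. (norm (orth_proj (H i) x))\<^sup>2) \<le> (norm x)\<^sup>2"
proof -
  let ?s = "\<Sum>i\<in>F. orth_proj (H i) x"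
  have ss: "(norm ?s)\<^sup>2 = (\<Sum>i\<in>F. (norm (orth_proj (H i) x))\<^sup>2)"
  proof (rule pythagoras_sum)
    fix i j assume "i \<in> F" "j \<in> F" "i \<noteq> j"
    with F show "inner (orth_proj (H i) x) (orth_proj (H j) x) = 0"
      by (intro orthogonal_familyD(3)[OF H, of i j] orthogonal_family_orth_proj_in[OF H]) auto
  qed (rule F)
  have "cinner ?s x = (\<Sum>i\<in>F. complex_of_real ((norm (orth_proj (H i) x))\<^sup>2))"
    unfolding cinner_sum_left using orthogonal_familyD(1)[OF H] F
    by (intro sum.cong cinner_orth_proj_self) auto
  then have "inner ?s x = (norm ?s)\<^sup>2"
    by (simp add: inner_eq_Re_cinner ss)
  moreover have "0 \<le> inner (x - ?s) (x - ?s)" by simp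
  ultimately show ?thesis
    unfolding ss[symmetric]
    by (simp add: inner_diff_left inner_diff_right inner_commute power2_norm_eq_inner)
qed

lemma orth_proj_summable_on:
  fixes H :: "'i \<Rightarrow> 'a::chilbert_space set"
  assumes H: "orthogonal_family I H" and K: "K \<ge> 0"
    and c: "\<And>i x. i \<in> I \<Longrightarrow> x \<in> H i \<Longrightarrow> norm (c i *\<^sub>R x) \<le> K * norm x"
  shows "(\<lambda>i. c i *\<^sub>R orth_proj (H i) x) summable_on I"
    and "norm (\<Sum>\<^sub>\<infinity>i\<in>I. c i *\<^sub>R orth_proj (H i) x) \<le> K * norm x"
proof -
  let ?f = "\<lambda>i. c i *\<^sub>R orth_proj (H i) x"
  have in_H: "orth_proj (H i) x \<in> H i" if "i \<in> I" for i
    using orthogonal_family_orth_proj_in[OF H that] .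
  have orth: "inner (?f i) (?f j) = 0" if "i \<in> I" "j \<in> I" "i \<noteq> j" for i j
    using orthogonal_familyD(3)[OF H that in_H in_H] that by simp
  have bound: "(\<Sum>i\<in>F. (norm (?f i))\<^sup>2) \<le> (K * norm x)\<^sup>2" if F: "finite F" "F \<subseteq> I" for F
  proof -
    have "(\<Sum>i\<in>F. (norm (?f i))\<^sup>2) \<le> (\<Sum>i\<in>F. (K * norm (orth_proj (H i) x))\<^sup>2)"
      using F in_H c by (intro sum_mono power_mono) auto
    also have "\<dots> = K\<^sup>2 * (\<Sum>i\<in>F. (norm (orth_proj (H i) x))\<^sup>2)"
      by (simp add: power_mult_distrib sum_distrib_left)
    also have "\<dots> \<le> K\<^sup>2 * (norm x)\<^sup>2"
      using bessel_inequality[OF H F] by (intro mult_left_mono) auto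
    finally show ?thesis by (simp add: power_mult_distrib)
  qed
  show summable: "?f summable_on I"
    using orth bound by (rule orthogonal_summable_on)
  have "norm (sum ?f F) \<le> K * norm x" if F: "finite F" "F \<subseteq> I" for F
  proof -
    have "(norm (sum ?f F))\<^sup>2 \<le> (K * norm x)\<^sup>2"
      using bound[OF F] F pythagoras_sum[OF F(1), of ?f] orth by (simp add: subset_iff)
    then show ?thesis by (rule power2_le_imp_le) (simp add: K)
  qed
  moreover have "(sum ?f \<longlongrightarrow> infsum ?f I) (finite_subsets_at_top I)"
    using has_sum_infsum[OF summable] by (simp add: has_sum_def)
  ultimately show "norm (infsum ?f I) \<le> K * norm x"
    using tendsto_upperbound[OF tendsto_norm, of "sum ?f"] eventually_finite_subsets_at_top_weakI
      finite_subsets_at_top_neq_bot by meson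
qed

text \<open>
  The difference between \<open>x\<close> and the sum of its projections is orthogonal to every summand, so a
  family with no nonzero common orthogonal vector recovers \<open>x\<close>.
\<close>

lemma has_sum_orth_proj:
  fixes H :: "'i \<Rightarrow> 'a::chilbert_space set"
  assumes H: "orthogonal_family I H"
    and total: "\<And>z. (\<And>i y. i \<in> I \<Longrightarrow> y \<in> H i \<Longrightarrow> cinner z y = 0) \<Longrightarrow> z = 0"
  shows "((\<lambda>i. orth_proj (H i) x) has_sum x) I"
proof -
  let ?f = "\<lambda>i. orth_proj (H i) x"
  have "?f summable_on I"
    using orth_proj_summable_on(1)[where K = 1 and c = "\<lambda>_. 1", OF H] by simp
  then obtain s where s: "(?f has_sum s) I" unfolding summable_on_def by blast
  have "x - s = 0"
  proof (rule total)
    fix i y assume i: "i \<in> I" and y: "y \<in> H i"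
    have "((\<lambda>j. cinner (?f j) y) has_sum cinner s y) I"
      by (rule has_sum_bounded_linear[OF bounded_linear_cinner_left s])
    moreover have "((\<lambda>j. cinner (?f j) y) has_sum cinner (?f i) y) I"
    proof (subst has_sum_cong_neutral[where T = "{i}" and g = "\<lambda>j. cinner (?f j) y"])
      fix j assume "j \<in> I - {i}"
      then show "cinner (?f j) y = 0"
        by (intro orthogonal_familyD(2)[OF H _ i _ orthogonal_family_orth_proj_in[OF H] y]) auto
    qed (use i in \<open>auto intro: has_sum_finiteI\<close>)
    ultimately have "cinner s y = cinner (?f i) y" by (rule has_sum_unique)
    then show "cinner (x - s) y = 0"
      using orth_proj_orthogonal[OF orthogonal_familyD(1)[OF H i] y, of x]
      by (simp add: cinner_diff_left)
  qed
  with s show ?thesis by simp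
qed

lemma hilbert_direct_sumI:
  fixes H :: "'i \<Rightarrow> 'a::chilbert_space set"
  assumes H: "orthogonal_family I H"
    and total: "\<And>z. (\<And>i y. i \<in> I \<Longrightarrow> y \<in> H i \<Longrightarrow> cinner z y = 0) \<Longrightarrow> z = 0"
  shows "hilbert_direct_sum I H"
proof -
  have "\<exists>f. (\<forall>i\<in>I. f i \<in> H i) \<and> (f has_sum x) I" for x
  proof -
    have "((\<lambda>i. orth_proj (H i) x) has_sum x) I"
      using H total by (rule has_sum_orth_proj)
    then show ?thesis
      using orthogonal_family_orth_proj_in[OF H]
      by (intro exI[of _ "\<lambda>i. orth_proj (H i) x"]) simp
  qed
  then show ?thesis
    using H unfolding hilbert_direct_sum_def orthogonal_family_def by blast
qed

lemma bounded_clinear_eqI_direct_sum: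
  assumes H: "hilbert_direct_sum I H"
    and S: "bounded_clinear S" and T: "bounded_clinear T"
    and eq: "\<And>i x. i \<in> I \<Longrightarrow> x \<in> H i \<Longrightarrow> S x = T x"
  shows "S = T"
proof
  fix x
  obtain f where f: "\<And>i. i \<in> I \<Longrightarrow> f i \<in> H i" "(f has_sum x) I"
    using H unfolding hilbert_direct_sum_def by metis
  have "((\<lambda>i. S (f i)) has_sum S x) I" "((\<lambda>i. T (f i)) has_sum T x) I"
    using S T has_sum_bounded_linear[OF _ f(2), of S] has_sum_bounded_linear[OF _ f(2), of T]
    unfolding bounded_clinear_def by simp_all
  moreover have "((\<lambda>i. S (f i)) has_sum S x) I \<longleftrightarrow> ((\<lambda>i. T (f i)) has_sum S x) I"
    using f eq by (intro has_sum_cong) auto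
  ultimately show "S x = T x" by (simp add: has_sum_unique)
qed

text \<open>
  Existence of the square root of \<open>T\<^sup>* T\<close> comes from this lemma: on a space spanned by eigenspaces
  the root can be written down as a diagonal operator.
\<close>

lemma positive_diagonal_operator_exists:
  fixes H :: "'i \<Rightarrow> 'a::chilbert_space set"
  assumes H: "orthogonal_family I H" and K: "K \<ge> 0"
    and c: "\<And>i. i \<in> I \<Longrightarrow> 0 \<le> c i"
    and bound: "\<And>i x. i \<in> I \<Longrightarrow> x \<in> H i \<Longrightarrow> norm (c i *\<^sub>R x) \<le> K * norm x"
  obtains D where "positive_op D" "\<And>i x. i \<in> I \<Longrightarrow> x \<in> H i \<Longrightarrow> D x = c i *\<^sub>R x"
proof -
  define D where "D x = (\<Sum>\<^sub>\<infinity>i\<in>I. c i *\<^sub>R orth_proj (H i) x)" for x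
  have D: "((\<lambda>i. c i *\<^sub>R orth_proj (H i) x) has_sum D x) I" for x
    unfolding D_def using orth_proj_summable_on(1)[where c = c, OF H K bound] by (rule has_sum_infsum)
  note closed = orthogonal_familyD(1)[OF H]
  have add: "D (x + y) = D x + D y" for x y
  proof (rule has_sum_unique[OF D])
    have "((\<lambda>i. c i *\<^sub>R orth_proj (H i) x + c i *\<^sub>R orth_proj (H i) y) has_sum D x + D y) I"
      by (intro has_sum_add D)
    then show "((\<lambda>i. c i *\<^sub>R orth_proj (H i) (x + y)) has_sum D x + D y) I"
      by (subst has_sum_cong) (auto simp: orth_proj_add closed scaleR_add_right)
  qed
  have scale: "D (a *\<^sub>C x) = a *\<^sub>C D x" for a x
  proof (rule has_sum_unique[OF D])
    have "((\<lambda>i. a *\<^sub>C (c i *\<^sub>R orth_proj (H i) x)) has_sum a *\<^sub>C D x) I"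
      by (rule has_sum_bounded_linear[OF bounded_linear_scaleC D])
    then show "((\<lambda>i. c i *\<^sub>R orth_proj (H i) (a *\<^sub>C x)) has_sum a *\<^sub>C D x) I"
      by (subst has_sum_cong)
        (auto simp: orth_proj_scaleC closed scaleR_scaleC scaleC_scaleC mult.commute)
  qed
  have "bounded_linear D"
  proof (rule bounded_linear_intro[where K = K])
    show "D (r *\<^sub>R x) = r *\<^sub>R D x" for r x by (simp add: scaleR_scaleC scale)
    show "norm (D x) \<le> norm x * K" for x
      using orth_proj_summable_on(2)[where c = c and x = x, OF H K bound] by (simp add: D_def mult.commute)
  qed (rule add)
  with scale have "bounded_clinear D" unfolding bounded_clinear_def by blast
  moreover have "Im (cinner (D x) x) = 0 \<and> 0 \<le> Re (cinner (D x) x)" for x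
  proof -
    have "((\<lambda>i. cinner (c i *\<^sub>R orth_proj (H i) x) x) has_sum cinner (D x) x) I"
      by (rule has_sum_bounded_linear[OF bounded_linear_cinner_left D])
    then have sum: "((\<lambda>i. complex_of_real (c i * (norm (orth_proj (H i) x))\<^sup>2)) has_sum
        cinner (D x) x) I"
      by (subst has_sum_cong)
        (auto simp: cinner_orth_proj_self closed scaleR_scaleC cinner_scaleC_left)
    have "((\<lambda>i. c i * (norm (orth_proj (H i) x))\<^sup>2) has_sum Re (cinner (D x) x)) I"
      using has_sum_bounded_linear[OF bounded_linear_Re sum] by simp
    moreover have "((\<lambda>i. 0) has_sum Im (cinner (D x) x)) I"
      using has_sum_bounded_linear[OF bounded_linear_Im sum] by simp
    moreover have "((\<lambda>i. 0::real) has_sum 0) I" by (rule has_sum_0) simp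
    ultimately show ?thesis
      using c by (auto intro: has_sum_unique has_sum_nonneg)
  qed
  moreover have "D x = c i *\<^sub>R x" if i: "i \<in> I" and x: "x \<in> H i" for i x
  proof (rule has_sum_unique[OF D])
    have "orth_proj (H j) x = 0" if "j \<in> I" "j \<noteq> i" for j
      using that i x orthogonal_familyD(2)[OF H, of i j] closed by (intro orth_proj_eq_0) auto
    then have "((\<lambda>j. c j *\<^sub>R orth_proj (H j) x) has_sum c i *\<^sub>R x) I \<longleftrightarrow>
        ((\<lambda>j. c j *\<^sub>R orth_proj (H j) x) has_sum c i *\<^sub>R x) {i}"
      using i by (intro has_sum_cong_neutral) auto
    then show "((\<lambda>j. c j *\<^sub>R orth_proj (H j) x) has_sum c i *\<^sub>R x) I"
      using orth_proj_id[OF closed[OF i] x] by (simp add: has_sum_finiteI)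
  qed
  ultimately show thesis using that unfolding positive_op_def by blast
qed

section \<open>Eigenspaces of \<open>T\<^sup>* T\<close>\<close>

definition eigenspace :: "('a::chilbert_space \<Rightarrow> 'a) \<Rightarrow> complex \<Rightarrow> 'a set"
  where "eigenspace A c = {x. A x = c *\<^sub>C x}"

text \<open>
  These will turn out to be the eigenspaces of \<open>|T|\<close> for \<open>b \<ge> 0\<close>, but they are described through
  \<open>T\<^sup>* T\<close> since the existence of \<open>|T|\<close> is deduced from them.
\<close>

definition singular_space :: "('a::chilbert_space \<Rightarrow> 'a) \<Rightarrow> real \<Rightarrow> 'a set"
  where "singular_space T b = eigenspace (cadjoint T \<circ> T) (complex_of_real (b\<^sup>2))"

lemma singular_space_iff:
  "x \<in> singular_space T b \<longleftrightarrow> cadjoint T (T x) = complex_of_real (b\<^sup>2) *\<^sub>C x"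
  by (simp add: singular_space_def eigenspace_def)

lemma closed_csubspace_eigenspace:
  assumes A: "bounded_clinear A"
  shows "closed_csubspace (eigenspace A c)"
proof -
  have "continuous_on UNIV A" "continuous_on UNIV (\<lambda>x. c *\<^sub>C x)"
    using A bounded_linear_scaleC linear_continuous_on unfolding bounded_clinear_def by blast+
  then have "closed (eigenspace A c)"
    unfolding eigenspace_def by (rule closed_Collect_eq)
  then show ?thesis
    by (auto simp: closed_csubspace_def eigenspace_def bounded_clinear_zero[OF A]
        bounded_clinear_add[OF A] bounded_clinear_scaleC[OF A] scaleC_zero_right scaleC_add_right
        scaleC_scaleC mult.commute)
qed

lemma closed_csubspace_orthogonal_compl:
  "closed_csubspace (orthogonal_compl M)" for M :: "'a::chilbert_space set"
proof -
  have "closed {x::'a. cinner x y = 0}" for y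
    using linear_continuous_on[OF bounded_linear_cinner_left]
    by (intro closed_Collect_eq continuous_on_const) auto
  then have "closed (\<Inter>y\<in>M. {x. cinner x y = 0})" by blast
  moreover have "(\<Inter>y\<in>M. {x. cinner x y = 0}) = orthogonal_compl M"
    by (auto simp: orthogonal_compl_def)
  ultimately show ?thesis
    by (auto simp: closed_csubspace_def orthogonal_compl_def cinner_zero_left cinner_add_left
        cinner_scaleC_left)
qed

lemma bounded_clinear_cadjoint_compose:
  "bounded_clinear T \<Longrightarrow> bounded_clinear (cadjoint T \<circ> T)"
  by (intro bounded_clinear_compose bounded_clinear_cadjoint)

lemma norm_on_singular_space:
  assumes T: "bounded_clinear T" and b: "b \<ge> 0" and x: "x \<in> singular_space T b"
  shows "norm (T x) = b * norm x"
proof -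
  have "complex_of_real ((norm (T x))\<^sup>2) = cinner (cadjoint T (T x)) x"
    by (simp only: cinner_cadjoint_left[OF T] cinner_self)
  also have "\<dots> = complex_of_real ((b * norm x)\<^sup>2)"
    using x by (simp add: singular_space_iff cinner_scaleC_left cinner_self power_mult_distrib)
  finally have "(norm (T x))\<^sup>2 = (b * norm x)\<^sup>2" by (simp only: of_real_eq_iff)
  then show ?thesis using b by (simp add: power2_eq_iff_nonneg)
qed

lemma singular_spaces_orthogonal:
  assumes T: "bounded_clinear T" and ab: "0 \<le> a" "0 \<le> b" "a \<noteq> b"
    and x: "x \<in> singular_space T a" and y: "y \<in> singular_space T b"
  shows "cinner x y = 0"
proof -
  have "complex_of_real (a\<^sup>2) * cinner x y = cinner (cadjoint T (T x)) y"
    using x by (simp add: singular_space_iff cinner_scaleC_left)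
  also have "\<dots> = cinner x (cadjoint T (T y))"
    by (simp add: cinner_cadjoint_left[OF T] cinner_cadjoint[OF T])
  also have "\<dots> = complex_of_real (b\<^sup>2) * cinner x y"
    using y by (simp add: singular_space_iff cinner_scaleC_right)
  finally have "a\<^sup>2 = b\<^sup>2 \<or> cinner x y = 0"
    by (auto simp only: mult_cancel_right of_real_eq_iff)
  then show ?thesis using ab by (simp add: power2_eq_iff_nonneg)
qed

lemma orthogonal_family_singular_spaces:
  assumes "bounded_clinear T"
  shows "orthogonal_family {0..} (singular_space T)"
  unfolding orthogonal_family_def
proof (intro conjI ballI impI)
  show "closed_csubspace (singular_space T b)" for b
    unfolding singular_space_def using assms
    by (intro closed_csubspace_eigenspace bounded_clinear_cadjoint_compose)
qed (use singular_spaces_orthogonal[OF assms] in auto)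

text \<open>
  A unit vector \<open>x\<close> minimising \<open>\<parallel>T y\<parallel>\<close> over the unit sphere of \<open>M\<close> minimises the form
  \<open>\<parallel>T y\<parallel>\<^sup>2 - \<parallel>T x\<parallel>\<^sup>2 \<parallel>y\<parallel>\<^sup>2\<close> over all of \<open>M\<close>. The first variation gives that \<open>T\<^sup>* T x - \<parallel>T x\<parallel>\<^sup>2 x\<close> is
  orthogonal to \<open>M\<close>, and invariance of \<open>M\<close> puts this vector into \<open>M\<close>.
\<close>

lemma minimum_attaining_on_imp_singular_vector:
  fixes T :: "'a::chilbert_space \<Rightarrow> 'a"
  assumes T: "bounded_clinear T" and M: "closed_csubspace M"
    and inv: "\<And>x. x \<in> M \<Longrightarrow> cadjoint T (T x) \<in> M"
    and min: "minimum_attaining_on M T"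
  obtains x where "x \<in> M" "norm x = 1" "x \<in> singular_space T (norm (T x))"
proof -
  obtain x where x: "x \<in> M" "norm x = 1" "norm (T x) = min_modulus_on M T"
    using min unfolding minimum_attaining_on_def by blast
  define m where "m = norm (T x)"
  have lower: "m * norm y \<le> norm (T y)" if y: "y \<in> M" for y
  proof (cases "y = 0")
    case False
    let ?z = "(1 / norm y) *\<^sub>R y"
    have z: "?z \<in> M" "norm ?z = 1"
      using False y M subspace_scale closed_csubspace_subspace by auto
    have "bdd_below {norm (T x) | x. x \<in> M \<and> norm x = 1}"
      by (rule bdd_belowI[of _ 0]) auto
    then have "m \<le> norm (T ?z)"
      unfolding m_def x(3) min_modulus_on_def using z by (intro cInf_lower) blast+
    also have "\<dots> = norm (T y) / norm y"
      by (simp add: bounded_clinear_scaleR[OF T])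
    finally show ?thesis using False by (simp add: field_simps)
  qed simp
  define v where "v = cadjoint T (T x) - complex_of_real (m\<^sup>2) *\<^sub>C x"
  have v_M: "v \<in> M"
    unfolding v_def using M inv x(1) by (intro closed_csubspace_diff closed_csubspace_scaleC)
  have v_inner: "inner v y = inner (T x) (T y) - m\<^sup>2 * inner x y" for y
    by (simp add: v_def inner_eq_Re_cinner cinner_diff_left cinner_scaleC_left
        cinner_cadjoint_left[OF T])
  have "inner v y = 0" if y: "y \<in> M" for y
  proof (rule linear_term_zero_of_quadratic_nonneg)
    fix t :: real
    have "x + t *\<^sub>R y \<in> M"
      using M x(1) y by (meson closed_csubspace_subspace subspace_add subspace_scale)
    then have "(m * norm (x + t *\<^sub>R y))\<^sup>2 \<le> (norm (T (x + t *\<^sub>R y)))\<^sup>2"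
      using lower by (intro power_mono) (auto simp: m_def)
    moreover have "(norm (T (x + t *\<^sub>R y)))\<^sup>2 =
        m\<^sup>2 + 2 * t * inner (T x) (T y) + t\<^sup>2 * (norm (T y))\<^sup>2"
      unfolding m_def power2_norm_eq_inner
      by (simp add: bounded_clinear_add[OF T] bounded_clinear_scaleR[OF T] inner_add_left
          inner_add_right inner_commute algebra_simps power2_eq_square[of t])
    moreover have "(m * norm (x + t *\<^sub>R y))\<^sup>2 =
        m\<^sup>2 * (1 + 2 * t * inner x y + t\<^sup>2 * (norm y)\<^sup>2)"
    proof -
      have "(norm (x + t *\<^sub>R y))\<^sup>2 = (norm x)\<^sup>2 + 2 * t * inner x y + t\<^sup>2 * (norm y)\<^sup>2"
        by (simp add: power2_norm_eq_inner inner_add_left inner_add_right inner_commute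
            algebra_simps power2_eq_square[of t])
      then show ?thesis by (simp add: power_mult_distrib x(2))
    qed
    ultimately show "0 \<le> 2 * t * inner v y + t\<^sup>2 * ((norm (T y))\<^sup>2 - m\<^sup>2 * (norm y)\<^sup>2)"
      by (simp add: v_inner algebra_simps)
  qed
  from this[OF v_M] have "v = 0" by simp
  then have "x \<in> singular_space T m" by (simp add: v_def singular_space_iff)
  with x that show thesis unfolding m_def by blast
qed

text \<open>
  The vectors orthogonal to all singular spaces form a closed subspace invariant under \<open>T\<^sup>* T\<close>. Were
  it nonzero, \<open>T\<close> would attain its minimum there, at a vector of some singular space.
\<close>

lemma absolutely_minimum_attaining_singular_spaces_total:
  fixes T :: "'a::chilbert_space \<Rightarrow> 'a"
  assumes AM: "absolutely_minimum_attaining T"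
    and z: "\<And>b y. b \<in> {0..} \<Longrightarrow> y \<in> singular_space T b \<Longrightarrow> cinner z y = 0"
  shows "z = 0"
proof (rule ccontr)
  assume "z \<noteq> 0"
  have T: "bounded_clinear T" using AM by (simp add: absolutely_minimum_attaining_def)
  define M where "M = orthogonal_compl (\<Union>b\<in>{0..}. singular_space T b)"
  have M: "closed_csubspace M" unfolding M_def by (rule closed_csubspace_orthogonal_compl)
  have MD: "cinner x y = 0" if "x \<in> M" "0 \<le> b" "y \<in> singular_space T b" for x y b
    using that by (auto simp: M_def orthogonal_compl_def)
  have "z \<in> M" using z by (auto simp: M_def orthogonal_compl_def)
  with \<open>z \<noteq> 0\<close> AM M have min: "minimum_attaining_on M T"
    unfolding absolutely_minimum_attaining_def by blast
  have inv: "cadjoint T (T x) \<in> M" if x: "x \<in> M" for x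
  proof -
    have "cinner (cadjoint T (T x)) y = 0" if "0 \<le> b" "y \<in> singular_space T b" for y b
    proof -
      have "cinner (cadjoint T (T x)) y = cinner x (cadjoint T (T y))"
        by (simp add: cinner_cadjoint_left[OF T] cinner_cadjoint[OF T])
      also have "\<dots> = 0"
        using MD[OF x that] that(2) by (simp add: singular_space_iff cinner_scaleC_right)
      finally show ?thesis .
    qed
    then show ?thesis by (auto simp: M_def orthogonal_compl_def)
  qed
  obtain x where x: "x \<in> M" "norm x = 1" "x \<in> singular_space T (norm (T x))"
    using minimum_attaining_on_imp_singular_vector[OF T M inv min] by blast
  then have "cinner x x = 0" using MD norm_ge_zero by blast
  with x(2) show False by (simp add: cinner_self)
qed

lemma hilbert_direct_sum_singular_spaces:
  fixes T :: "'a::chilbert_space \<Rightarrow> 'a"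
  assumes AM: "absolutely_minimum_attaining T"
  shows "hilbert_direct_sum {0..} (singular_space T)"
proof (rule hilbert_direct_sumI)
  show "orthogonal_family {0..} (singular_space T)"
    using AM orthogonal_family_singular_spaces by (auto simp: absolutely_minimum_attaining_def)
qed (rule absolutely_minimum_attaining_singular_spaces_total[OF AM])

section \<open>The modulus\<close>

lemma positive_op_bounded_clinear: "positive_op S \<Longrightarrow> bounded_clinear S"
  by (simp add: positive_op_def)

lemma positive_op_eigenvalue:
  assumes S: "positive_op S" and x: "x \<in> eigenspace S c" "x \<noteq> 0"
  shows "c = complex_of_real (cmod c)"
proof -
  have "cinner (S x) x = c * complex_of_real ((norm x)\<^sup>2)"
    using x by (simp add: eigenspace_def cinner_scaleC_left cinner_self)
  moreover have "Im (cinner (S x) x) = 0" "0 \<le> Re (cinner (S x) x)"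
    using S by (auto simp: positive_op_def)
  ultimately have "Im c * (norm x)\<^sup>2 = 0" "0 \<le> Re c * (norm x)\<^sup>2"
    by simp_all
  then have "Im c = 0" "0 \<le> Re c"
    using x(2) by (auto simp: zero_le_mult_iff)
  then show ?thesis by (simp add: complex_eq_iff cmod_eq_Re)
qed

text \<open>
  If \<open>S\<^sup>2 x = b\<^sup>2 x\<close>, then \<open>(S + b) y = 0\<close> for \<open>y = S x - b x\<close>. For \<open>b > 0\<close> this forces \<open>y = 0\<close> because \<open>S\<close> has
  no negative eigenvalue. For \<open>b = 0\<close> the vector \<open>y = S x\<close> satisfies \<open>S y = 0\<close>, and positivity of \<open>S\<close>
  along the line \<open>y + t x\<close> forces \<open>y = 0\<close>.
\<close>

lemma eigenspace_square_positive_op: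
  assumes S: "positive_op S" and b: "0 \<le> b"
  shows "eigenspace (S \<circ> S) (complex_of_real (b\<^sup>2)) \<subseteq> eigenspace S (complex_of_real b)"
proof
  fix x assume "x \<in> eigenspace (S \<circ> S) (complex_of_real (b\<^sup>2))"
  then have SS: "S (S x) = complex_of_real (b\<^sup>2) *\<^sub>C x" by (simp add: eigenspace_def)
  note cl = positive_op_bounded_clinear[OF S]
  define y where "y = S x - complex_of_real b *\<^sub>C x"
  have Sy: "S y = complex_of_real (- b) *\<^sub>C y"
  proof -
    have "S y = complex_of_real (b\<^sup>2) *\<^sub>C x - complex_of_real b *\<^sub>C S x"
      by (simp add: y_def bounded_clinear_diff[OF cl] bounded_clinear_scaleC[OF cl] SS)
    also have "\<dots> = complex_of_real (- b) *\<^sub>C y"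
      by (simp add: y_def scaleC_diff_right scaleC_scaleC power2_eq_square scaleC_minus_left)
    finally show ?thesis .
  qed
  have "y = 0"
  proof (cases "b = 0")
    case False
    have "y \<in> eigenspace S (complex_of_real (- b))" using Sy by (simp add: eigenspace_def)
    then show ?thesis
      using positive_op_eigenvalue[OF S, of y "complex_of_real (- b)"] b False
      by (auto simp: complex_eq_iff)
  next
    case True
    then have y: "S x = y" "S y = 0"
      using Sy by (simp_all add: y_def scaleC_zero_left)
    have "0 \<le> 2 * t * (inner y y / 2) + t\<^sup>2 * inner y x" for t
    proof -
      have "0 \<le> inner (S (y + t *\<^sub>R x)) (y + t *\<^sub>R x)"
        using S by (auto simp: positive_op_def inner_eq_Re_cinner)
      then show ?thesis
        by (simp add: bounded_clinear_add[OF cl] bounded_clinear_scaleR[OF cl] y inner_add_right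
            algebra_simps power2_eq_square)
    qed
    then have "inner y y / 2 = 0" by (rule linear_term_zero_of_quadratic_nonneg)
    then show ?thesis by simp
  qed
  then show "x \<in> eigenspace S (complex_of_real b)" by (simp add: y_def eigenspace_def)
qed

text \<open>
  The modulus is defined by a definite description, so both existence and uniqueness of the positive
  square root have to be established; both use that the singular spaces span the space.
\<close>

lemma modulus_op_properties:
  fixes T :: "'a::chilbert_space \<Rightarrow> 'a"
  assumes AM: "absolutely_minimum_attaining T"
  shows "positive_op (modulus_op T) \<and> modulus_op T \<circ> modulus_op T = cadjoint T \<circ> T"
proof -
  have T: "bounded_clinear T" using AM by (simp add: absolutely_minimum_attaining_def)
  let ?A = "cadjoint T \<circ> T"
  note sum = hilbert_direct_sum_singular_spaces[OF AM]
  obtain K where K: "K \<ge> 0" "\<And>x. norm (T x) \<le> K * norm x"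
    using bounded_clinear_bound[OF T] by blast
  have bound: "norm (b *\<^sub>R x) \<le> K * norm x" if "b \<in> {0..}" "x \<in> singular_space T b" for b x
    using norm_on_singular_space[OF T _ that(2)] that(1) K(2)[of x] by simp
  obtain D where D: "positive_op D" "\<And>b x. b \<in> {0..} \<Longrightarrow> x \<in> singular_space T b \<Longrightarrow> D x = b *\<^sub>R x"
    using positive_diagonal_operator_exists[where c = "\<lambda>b. b",
        OF orthogonal_family_singular_spaces[OF T] K(1) _ bound] by auto
  have "D \<circ> D = ?A"
  proof (rule bounded_clinear_eqI_direct_sum[OF sum])
    fix b x assume x: "b \<in> {0..}" "x \<in> singular_space T b"
    show "(D \<circ> D) x = ?A x"
      using D(2)[OF x] x(2) bounded_clinear_scaleR[OF positive_op_bounded_clinear[OF D(1)], of b x]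
      by (simp add: singular_space_iff scaleR_scaleC scaleC_scaleC power2_eq_square)
  qed (use D(1) T in \<open>auto intro: bounded_clinear_compose positive_op_bounded_clinear
        bounded_clinear_cadjoint_compose\<close>)
  moreover have "S = R" if S: "positive_op S" "S \<circ> S = ?A" and R: "positive_op R" "R \<circ> R = ?A"
    for S R
  proof (rule bounded_clinear_eqI_direct_sum[OF sum])
    fix b x assume "b \<in> {0..}" "x \<in> singular_space T b"
    then have "x \<in> eigenspace S (complex_of_real b)" "x \<in> eigenspace R (complex_of_real b)"
      using eigenspace_square_positive_op[OF S(1), of b] eigenspace_square_positive_op[OF R(1), of b]
      unfolding S(2) R(2) singular_space_def by auto
    then show "S x = R x" by (simp add: eigenspace_def)
  qed (use S R positive_op_bounded_clinear in blast)+
  ultimately have "\<exists>!S. positive_op S \<and> S \<circ> S = ?A"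
    using D(1) by blast
  from theI'[OF this] show ?thesis unfolding modulus_op_def sqrt_op_def .
qed

lemma eigenspace_modulus_op:
  fixes T :: "'a::chilbert_space \<Rightarrow> 'a"
  assumes AM: "absolutely_minimum_attaining T" and b: "0 \<le> b"
  shows "eigenspace (modulus_op T) (complex_of_real b) = singular_space T b"
proof
  have S: "positive_op (modulus_op T)" "modulus_op T \<circ> modulus_op T = cadjoint T \<circ> T"
    using modulus_op_properties[OF AM] by auto
  show "singular_space T b \<subseteq> eigenspace (modulus_op T) (complex_of_real b)"
    using eigenspace_square_positive_op[OF S(1) b] unfolding S(2) singular_space_def .
  show "eigenspace (modulus_op T) (complex_of_real b) \<subseteq> singular_space T b"
    unfolding singular_space_def S(2)[symmetric]
    by (auto simp: eigenspace_def scaleC_scaleC power2_eq_square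
        bounded_clinear_scaleC[OF positive_op_bounded_clinear[OF S(1)]])
qed

text \<open>
  An operator commuting with \<open>T\<^sup>* T\<close> preserves the singular spaces, and \<open>|T|\<close> is a scalar on each of
  them.
\<close>

lemma commutes_with_modulus_op:
  fixes T :: "'a::chilbert_space \<Rightarrow> 'a"
  assumes AM: "absolutely_minimum_attaining T" and R: "bounded_clinear R"
    and commute: "R \<circ> (cadjoint T \<circ> T) = (cadjoint T \<circ> T) \<circ> R"
  shows "R \<circ> modulus_op T = modulus_op T \<circ> R"
proof (rule bounded_clinear_eqI_direct_sum[OF hilbert_direct_sum_singular_spaces[OF AM]])
  have S: "positive_op (modulus_op T)" using modulus_op_properties[OF AM] by simp
  show "bounded_clinear (R \<circ> modulus_op T)" "bounded_clinear (modulus_op T \<circ> R)"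
    using R positive_op_bounded_clinear[OF S] by (auto intro: bounded_clinear_compose)
  fix b x assume b: "b \<in> {0..}" and x: "x \<in> singular_space T b"
  have "cadjoint T (T (R x)) = R (cadjoint T (T x))"
    using fun_cong[OF commute, of x] by simp
  then have "R x \<in> singular_space T b"
    using x by (simp add: singular_space_iff bounded_clinear_scaleC[OF R])
  with x b have "{x, R x} \<subseteq> eigenspace (modulus_op T) (complex_of_real b)"
    using eigenspace_modulus_op[OF AM, of b] by simp
  then show "(R \<circ> modulus_op T) x = (modulus_op T \<circ> R) x"
    by (simp add: eigenspace_def bounded_clinear_scaleC[OF R])
qed

lemma eigenvalue_in_spectrum:
  assumes x: "x \<in> eigenspace A c" "x \<noteq> 0"
  shows "c \<in> spectrum A"
proof (rule ccontr)
  assume "c \<notin> spectrum A"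
  then obtain B where B: "bounded_clinear B" "B (A x - c *\<^sub>C x) = x"
    unfolding spectrum_def by blast
  then show False using x bounded_clinear_zero[OF B(1)] by (simp add: eigenspace_def)
qed

section \<open>Normal operators on the eigenspaces of the modulus\<close>

lemma commutes_eigenspace_invariant:
  assumes "R \<circ> S = S \<circ> R" "bounded_clinear R" "x \<in> eigenspace S c"
  shows "R x \<in> eigenspace S c"
  using fun_cong[OF assms(1), of x] assms(2,3)
  by (simp add: eigenspace_def bounded_clinear_scaleC)

lemma
  fixes T :: "'a::chilbert_space \<Rightarrow> 'a"
  assumes AM: "absolutely_minimum_attaining T" and normal: "normal_op T"
    and x: "x \<in> eigenspace (modulus_op T) c"
  shows normal_eigenspace_invariant: "T x \<in> eigenspace (modulus_op T) c"
    and normal_eigenspace_invariant_cadjoint: "cadjoint T x \<in> eigenspace (modulus_op T) c"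
proof -
  have T: "bounded_clinear T" using AM by (simp add: absolutely_minimum_attaining_def)
  have comm: "T (cadjoint T y) = cadjoint T (T y)" for y
    using normal unfolding normal_op_def by (metis comp_apply)
  have "T \<circ> modulus_op T = modulus_op T \<circ> T"
    by (rule commutes_with_modulus_op[OF AM T]) (simp add: fun_eq_iff comm)
  then show "T x \<in> eigenspace (modulus_op T) c"
    using T x by (rule commutes_eigenspace_invariant)
  have "cadjoint T \<circ> modulus_op T = modulus_op T \<circ> cadjoint T"
    by (rule commutes_with_modulus_op[OF AM bounded_clinear_cadjoint[OF T]])
      (simp add: fun_eq_iff comm)
  then show "cadjoint T x \<in> eigenspace (modulus_op T) c"
    using bounded_clinear_cadjoint[OF T] x by (rule commutes_eigenspace_invariant)
qed

lemma reducing_subspace_eigenspace_modulus_op: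
  fixes T :: "'a::chilbert_space \<Rightarrow> 'a"
  assumes AM: "absolutely_minimum_attaining T" and normal: "normal_op T"
  shows "reducing_subspace T (eigenspace (modulus_op T) c)"
  unfolding reducing_subspace_def
proof (intro conjI)
  have T: "bounded_clinear T" using AM by (simp add: absolutely_minimum_attaining_def)
  let ?E = "eigenspace (modulus_op T) c"
  show "closed_csubspace ?E"
    using modulus_op_properties[OF AM]
    by (intro closed_csubspace_eigenspace positive_op_bounded_clinear) simp
  show "T ` ?E \<subseteq> ?E"
    using normal_eigenspace_invariant[OF AM normal] by blast
  show "T ` orthogonal_compl ?E \<subseteq> orthogonal_compl ?E"
    using normal_eigenspace_invariant_cadjoint[OF AM normal]
    by (auto simp: orthogonal_compl_def cinner_cadjoint[OF T])
qed

lemma bounded_operator_on_bounded_clinear: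
  assumes T: "bounded_clinear T" and "\<And>x. x \<in> M \<Longrightarrow> T x \<in> M"
  shows "bounded_operator_on M T"
  using assms bounded_clinear_bound[OF T] unfolding bounded_operator_on_def
  by (metis bounded_clinear_add bounded_clinear_scaleC image_subsetI)

text \<open>
  On the eigenspace \<open>T\<^sup>* T = T T\<^sup>* = \<bar>c\<bar>\<^sup>2\<close>, so \<open>T\<^sup>*\<close> divided by \<open>cnj c\<close> is both the adjoint and the
  inverse of \<open>T\<close> divided by \<open>c\<close>.
\<close>

lemma unitary_on_eigenspace_modulus_op:
  fixes T :: "'a::chilbert_space \<Rightarrow> 'a"
  assumes AM: "absolutely_minimum_attaining T" and normal: "normal_op T" and c: "c \<noteq> 0"
  shows "unitary_on (eigenspace (modulus_op T) c) (\<lambda>x. (1 / c) *\<^sub>C T x)"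
proof -
  have T: "bounded_clinear T" using AM by (simp add: absolutely_minimum_attaining_def)
  have S: "positive_op (modulus_op T)" using modulus_op_properties[OF AM] by simp
  let ?E = "eigenspace (modulus_op T) c"
  let ?U = "\<lambda>x. (1 / c) *\<^sub>C T x" and ?V = "\<lambda>x. (1 / cnj c) *\<^sub>C cadjoint T x"
  have E: "closed_csubspace ?E"
    using S by (intro closed_csubspace_eigenspace positive_op_bounded_clinear)
  have scaled: "bounded_clinear (\<lambda>x. a *\<^sub>C R x)" if "bounded_clinear R" for a and R :: "'a \<Rightarrow> 'a"
    using bounded_linear_compose[OF bounded_linear_scaleC, of R a] that
    by (auto simp: bounded_clinear_def scaleC_scaleC mult.commute)
  have "bounded_operator_on ?E ?U"
    using scaled[OF T] closed_csubspace_scaleC[OF E] normal_eigenspace_invariant[OF AM normal]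
    by (intro bounded_operator_on_bounded_clinear) auto
  moreover have "bounded_operator_on ?E ?V"
    using scaled[OF bounded_clinear_cadjoint[OF T]] closed_csubspace_scaleC[OF E]
      normal_eigenspace_invariant_cadjoint[OF AM normal]
    by (intro bounded_operator_on_bounded_clinear) auto
  moreover have "cinner (?U x) y = cinner x (?V y)" for x y
    by (simp add: cinner_scaleC_left cinner_scaleC_right cinner_cadjoint[OF T])
  moreover have TT: "cadjoint T (T x) = (c * cnj c) *\<^sub>C x" if x: "x \<in> ?E" for x
  proof (cases "x = 0")
    case False
    have real: "c = complex_of_real (cmod c)" using positive_op_eigenvalue[OF S x False] .
    then have "x \<in> singular_space T (cmod c)"
      using x eigenspace_modulus_op[OF AM, of "cmod c"] by simp
    then show ?thesis by (simp only: singular_space_iff complex_norm_square)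
  qed (simp add: bounded_clinear_zero[OF T] bounded_clinear_zero[OF bounded_clinear_cadjoint[OF T]]
      scaleC_zero_right)
  have "?V (?U x) = x" if "x \<in> ?E" for x
    using TT[OF that] c
    by (simp add: bounded_clinear_scaleC[OF bounded_clinear_cadjoint[OF T]] scaleC_scaleC scaleC_one)
  moreover have "?U (?V x) = x" if "x \<in> ?E" for x
  proof -
    have "T (cadjoint T x) = cadjoint T (T x)"
      using normal unfolding normal_op_def by (metis comp_apply)
    then show ?thesis
      using TT[OF that] c by (simp add: bounded_clinear_scaleC[OF T] scaleC_scaleC scaleC_one)
  qed
  ultimately show ?thesis unfolding unitary_on_def by blast
qed

lemma unitary_on_id: "unitary_on M (\<lambda>x. x)"
proof -
  have "bounded_operator_on M (\<lambda>x. x)"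
    unfolding bounded_operator_on_def by (auto intro: exI[of _ 1])
  then show ?thesis unfolding unitary_on_def by blast
qed

lemma hilbert_direct_sum_eigenspaces_modulus_op:
  fixes T :: "'a::chilbert_space \<Rightarrow> 'a"
  assumes AM: "absolutely_minimum_attaining T"
  shows "hilbert_direct_sum (spectrum (modulus_op T)) (eigenspace (modulus_op T))"
proof (rule hilbert_direct_sumI)
  let ?E = "eigenspace (modulus_op T)"
  have T: "bounded_clinear T" using AM by (simp add: absolutely_minimum_attaining_def)
  have S: "positive_op (modulus_op T)" using modulus_op_properties[OF AM] by simp
  have sub: "x \<in> singular_space T (cmod c)" "c = complex_of_real (cmod c)"
    if "x \<in> ?E c" "x \<noteq> 0" for x c
    using positive_op_eigenvalue[OF S that] eigenspace_modulus_op[OF AM, of "cmod c"] that(1)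
    by simp_all
  show "orthogonal_family (spectrum (modulus_op T)) ?E"
    unfolding orthogonal_family_def
  proof (intro conjI ballI impI)
    show "closed_csubspace (?E c)" for c
      using S by (intro closed_csubspace_eigenspace positive_op_bounded_clinear)
    fix c d x y assume cd: "c \<noteq> d" and xy: "x \<in> ?E c" "y \<in> ?E d"
    show "cinner x y = 0"
    proof (cases "x = 0 \<or> y = 0")
      case False
      then have "cmod c \<noteq> cmod d" using sub(2) xy cd by metis
      then show ?thesis
        using False sub(1) xy by (intro singular_spaces_orthogonal[OF T, of "cmod c" "cmod d"]) auto
    qed (auto simp: cinner_zero_left cinner_zero_right)
  qed
  \<comment> \<open>Every nonzero singular space belongs to a point of the spectrum, so restricting the index set
    to the spectrum loses nothing.\<close>
  fix z assume z: "\<And>c y. c \<in> spectrum (modulus_op T) \<Longrightarrow> y \<in> ?E c \<Longrightarrow> cinner z y = 0"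
  show "z = 0"
  proof (rule absolutely_minimum_attaining_singular_spaces_total[OF AM])
    fix b y assume "b \<in> {0..}" and y: "y \<in> singular_space T b"
    then have y': "y \<in> ?E (complex_of_real b)" using eigenspace_modulus_op[OF AM, of b] by simp
    show "cinner z y = 0"
    proof (cases "y = 0")
      case False
      then show ?thesis using z[OF eigenvalue_in_spectrum[OF y'] y'] by simp
    qed (simp add: cinner_zero_right)
  qed
qed

theorem theorem4p7:
  fixes T :: "'a::chilbert_space \<Rightarrow> 'a"
    and \<Lambda> :: "complex set"
  assumes "bounded_clinear T"
    and "normal_op T"
    and "absolutely_minimum_attaining T"
    and "\<Lambda> = spectrum (modulus_op T)"
  shows "\<exists>(H :: complex \<Rightarrow> 'a set) (U :: complex \<Rightarrow> 'a \<Rightarrow> 'a).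
    (\<forall>\<beta>\<in>\<Lambda>. reducing_subspace T (H \<beta>) \<and> unitary_on (H \<beta>) (U \<beta>)) \<and>
    hilbert_direct_sum \<Lambda> H \<and>
    (\<forall>\<beta>\<in>\<Lambda>. \<forall>x\<in>H \<beta>. T x = \<beta> *\<^sub>C U \<beta> x)"
proof -
  let ?H = "eigenspace (modulus_op T)"
  define U where "U \<beta> = (if \<beta> = 0 then (\<lambda>x. x) else (\<lambda>x. (1 / \<beta>) *\<^sub>C T x))" for \<beta>
  have "reducing_subspace T (?H \<beta>)" for \<beta>
    using assms by (intro reducing_subspace_eigenspace_modulus_op)
  moreover have "unitary_on (?H \<beta>) (U \<beta>)" for \<beta>
    using unitary_on_eigenspace_modulus_op[OF assms(3,2)] by (simp add: U_def unitary_on_id)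
  moreover have "hilbert_direct_sum \<Lambda> ?H"
    unfolding assms(4) using assms(3) by (rule hilbert_direct_sum_eigenspaces_modulus_op)
  moreover have "T x = \<beta> *\<^sub>C U \<beta> x" if x: "x \<in> ?H \<beta>" for \<beta> x
  proof (cases "\<beta> = 0")
    case True
    then have "x \<in> singular_space T 0"
      using x eigenspace_modulus_op[OF assms(3), of 0] by simp
    then have "norm (T x) = 0"
      using norm_on_singular_space[OF assms(1), of 0 x] by simp
    then show ?thesis by (simp add: True scaleC_zero_left)
  qed (simp add: U_def scaleC_scaleC scaleC_one)
  ultimately show ?thesis by blast
qed

end
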